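(* Let $\nu=\nu_1\nu_2\cdots\nu_{k-1}$ be a word of distinct integers in $[k]$, let $r$ be the unique element of $[k]\setminus\{\nu_1,\ldots,\nu_{k-1}\}$, and let $i\in[k-1]$. If $r>\nu_i$ or $\nu_i\notin\mathrm{Lmax}(\nu)$, then $$(\nu;\,r\to\nu_i)\ \sim\ (\nu^{(i,r)};\,r\to\nu_i)\ \sim\ (\nu_1\cdots\nu_{i-1}\,r\,\nu_i\,\nu_{i+1}\cdots\nu_{k-1};\,r\to\nu_i),$$ where $\nu^{(i,r)}=\nu_1\cdots\nu_{i-1}\,r\,\nu_{i+1}\cdots\nu_{k-1}$ is the word obtained from $\nu$ by replacing the entry $\nu_i$ with $r$.
   Context: $[n]=\{1,\dots,n\}$, and $\mathcal{S}_n$ is the set of permutations $\pi=\pi_1\pi_2\cdots\pi_n$ of $[n]$ in one-line notation. For a word $w$ of distinct integers, $w_i$ is a left-to-right maximum if $w_i>w_j$ for all $j<i$; $\mathrm{Lmax}(w)$ is the set of all left-to-right maxima of $w$. The permutation $\hat\pi$: for $\pi\in\mathcal{S}_n$, $\hat\pi\in\mathcal{S}_n$ is the permutation whose cycle form is obtained from the word $\pi_1\cdots\pi_n$ by inserting a left parenthesis before each left-to-right maximum and a right parenthesis immediately before the next left-to-right maximum, or at the end of the word. A cycle $(c_1,c_2,\dots,c_s)$ means $c_1\mapsto c_2\mapsto\cdots\mapsto c_s\mapsto c_1$. Example: if $\pi=2537164$ then $\hat\pi=(2)(53)(7164)$. Arrow patterns: an arrow pattern of size $k$ is a pair $(\nu;H)$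 where $\nu=\nu_1\cdots\nu_m$ is a word of distinct positive integers, $H$ is a collection of arrows $b_i\to c_i$, and the set of all integers appearing in $\nu$ or $H$ is $[k]$. A permutation $\pi\in\mathcal{S}_n$ contains $(\nu;H)$ if there are a set $X=\{x_1<x_2<\cdots<x_k\}\subseteq[n]$ and indices $t_1<\cdots<t_m$ such that $\pi_{t_1}\pi_{t_2}\cdots\pi_{t_m}=x_{\nu_1}x_{\nu_2}\cdots x_{\nu_m}$ and $\hat\pi(x_{b_i})=x_{c_i}$ for every arrow $b_i\to c_i$ in $H$. Otherwise $\pi$ avoids $(\nu;H)$. $\mathcal{S}_n(\nu;H)$ is the set of permutations in $\mathcal{S}_n$ avoiding $(\nu;H)$. Two arrow patterns $\alpha,\beta$ are arrow-Wilf-equivalent, written $\alpha\sim\beta$, if $|\mathcal{S}_n(\alpha)|=|\mathcal{S}_n(\beta)|$ for all $n\ge 1$. *)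

theory Defs
  imports "HOL-Combinatorics.Multiset_Permutations" "HOL-Combinatorics.Cycles"
begin

text \<open>
  Permutations of \<open>[n]\<close> are given in one-line notation, as the elements of
  \<open>permutations_of_set {1..n}\<close>. Words are lists, so the entry
  \<open>w\<^sub>i\<close> of the mathematical text is \<open>w ! (i - 1)\<close>.
\<close>

definition Lmax :: "nat list \<Rightarrow> nat set" where
  "Lmax w = {w ! i | i. i < length w \<and> (\<forall>j<i. w ! j < w ! i)}"

text \<open>
  Cut a word before each letter belonging to \<open>M\<close>. For \<open>M = Lmax w\<close> the first letter of
  \<open>w\<close> is in \<open>M\<close>, so every block starts with a left-to-right maximum.
\<close>

function cut_before :: "nat set \<Rightarrow> nat list \<Rightarrow> nat list list" where
  "cut_before M [] = []"
| "cut_before M (x # xs) =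
     (x # takeWhile (\<lambda>y. y \<notin> M) xs) # cut_before M (dropWhile (\<lambda>y. y \<notin> M) xs)"
  by pat_completeness auto
termination
  by (relation "measure (length \<circ> snd)") (auto simp: le_imp_less_Suc length_dropWhile_le)

text \<open>
  \<open>cycle_of_list [c\<^sub>1, \<dots>, c\<^sub>s]\<close> maps each \<open>c\<^sub>j\<close> to \<open>c\<^sub>j\<^sub>+\<^sub>1\<close> and \<open>c\<^sub>s\<close> to \<open>c\<^sub>1\<close>. For a word with
  distinct letters the cycles are disjoint, so the order of composition is irrelevant.
\<close>

definition hat :: "nat list \<Rightarrow> nat \<Rightarrow> nat" where
  "hat w = foldr (\<lambda>c f. cycle_of_list c \<circ> f) (cut_before (Lmax w) w) id"

text \<open>A pattern \<open>(\<nu>, H)\<close>; a pair \<open>(b, c) \<in> H\<close> is the arrow from \<open>b\<close> to \<open>c\<close>.\<close>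

type_synonym pattern = "nat list \<times> (nat \<times> nat) set"

definition letters :: "pattern \<Rightarrow> nat set" where
  "letters = (\<lambda>(\<nu>, H). set \<nu> \<union> Field H)"

definition pattern_size :: "pattern \<Rightarrow> nat" where
  "pattern_size p = card (letters p)"

definition arrow_pattern :: "pattern \<Rightarrow> bool" where
  "arrow_pattern p \<longleftrightarrow> distinct (fst p) \<and> letters p = {1..pattern_size p}"

text \<open>
  The set \<open>X = {x\<^sub>1 < \<dots> < x\<^sub>k}\<close> is represented by its increasing enumeration \<open>x\<close>.
  The positions \<open>t\<close> are counted from 0.
\<close>

definition contains_pattern :: "nat list \<Rightarrow> pattern \<Rightarrow> bool" where
  "contains_pattern w = (\<lambda>(\<nu>, H). \<exists>(x :: nat \<Rightarrow> nat) (t :: nat \<Rightarrow> nat).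
     strict_mono_on {1..pattern_size (\<nu>, H)} x \<and>
     x ` {1..pattern_size (\<nu>, H)} \<subseteq> {1..length w} \<and>
     strict_mono_on {..<length \<nu>} t \<and>
     t ` {..<length \<nu>} \<subseteq> {..<length w} \<and>
     (\<forall>j<length \<nu>. w ! t j = x (\<nu> ! j)) \<and>
     (\<forall>(b, c)\<in>H. hat w (x b) = x c))"

definition avoiders :: "nat \<Rightarrow> pattern \<Rightarrow> nat list set" where
  "avoiders n p = {w \<in> permutations_of_set {1..n}. \<not> contains_pattern w p}"

definition arrow_Wilf_equiv :: "pattern \<Rightarrow> pattern \<Rightarrow> bool" (infix \<open>\<sim>\<close> 50) where
  "\<alpha> \<sim> \<beta> \<longleftrightarrow> arrow_pattern \<alpha> \<and> arrow_pattern \<beta> \<and>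
     (\<forall>n\<ge>1. card (avoiders n \<alpha>) = card (avoiders n \<beta>))"

end

theory Submission
  imports Defs "HOL-Library.Sublist"
begin

text \<open>
  All three patterns are contained in the same permutations. If \<open>hat \<pi> a = b \<noteq> a\<close>, then either
  \<open>a\<close> immediately precedes \<open>b\<close> in \<open>\<pi>\<close>, or \<open>b\<close> is the left-to-right maximum opening the cycle
  closed by \<open>a\<close>, and then every other letter of \<open>\<pi>\<close> up to \<open>a\<close> is smaller than \<open>b\<close>. The
  hypothesis on \<open>r\<close> and \<open>\<nu>\<^sub>i\<close> excludes the second case for the arrow of an occurrence of the
  first or second pattern; so the two letters are adjacent in \<open>\<pi>\<close>, and the one missing from
  the occurrence can be inserted next to the other, giving an occurrence of the third pattern.
\<close>

section \<open>Cycles and left-to-right maxima\<close>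

lemma concat_cut_before: "concat (cut_before M w) = w"
  by (induction M w rule: cut_before.induct) auto

text \<open>For an arbitrary \<open>M\<close> the first block may open with a letter outside
  \<open>M\<close>, hence the alternative \<open>u = []\<close>. Only the later cuts are guaranteed
  to fall before elements of \<open>M\<close>.\<close>

lemma cut_before_block:
  assumes "c \<in> set (cut_before M w)"
  shows "\<exists>u v. w = u @ c @ v \<and> c \<noteq> [] \<and> set (tl c) \<inter> M = {} \<and> (u = [] \<or> hd c \<in> M)"
  using assms
proof (induction M w rule: cut_before.induct)
  case (2 M x xs)
  let ?D = "dropWhile (\<lambda>y. y \<notin> M) xs" and ?T = "takeWhile (\<lambda>y. y \<notin> M) xs"
  show ?case
  proof (cases "c = x # ?T")
    case True
    moreover have "set ?T \<inter> M = {}"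
      by (auto dest: set_takeWhileD)
    ultimately show ?thesis
      by (intro exI[of _ "[]"] exI[of _ ?D]) auto
  next
    case False
    then obtain u v where *: "?D = u @ c @ v" "c \<noteq> []" "set (tl c) \<inter> M = {}" "u = [] \<or> hd c \<in> M"
      using "2.IH" "2.prems" by auto
    \<comment> \<open>If \<open>c\<close> comes first in \<open>?D\<close>, its head is the letter
      at which \<open>dropWhile\<close> stopped; otherwise the induction hypothesis applies.\<close>
    have "hd c \<in> M"
    proof (cases "u = []")
      case True
      then have "?D \<noteq> []" and "hd ?D = hd c"
        using * by auto
      then show ?thesis
        using hd_dropWhile[of "\<lambda>y. y \<notin> M" xs] by auto
    qed (use * in auto)
    moreover have "x # xs = (x # ?T @ u) @ c @ v"
      using takeWhile_dropWhile_id[of "\<lambda>y. y \<notin> M" xs] *(1) by simp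
    ultimately show ?thesis
      using * by blast
  qed
qed simp

lemma foldr_cycles_outside:
  "a \<notin> set (concat cs) \<Longrightarrow> foldr (\<lambda>c f. cycle_of_list c \<circ> f) cs id a = a"
  by (induction cs) (auto simp: id_outside_supp)

lemma cycle_of_list_in: "a \<in> set c \<Longrightarrow> cycle_of_list c a \<in> set c"
  by (metis cycle_permutes permutes_in_image)

text \<open>The blocks are disjoint: those composed on the right of \<open>c\<close> fix
  \<open>a\<close>, and those on the left fix its image, which lies in \<open>c\<close>
  again.\<close>

lemma foldr_cycles_inside:
  assumes "distinct (concat cs)" "c \<in> set cs" "a \<in> set c"
  shows "foldr (\<lambda>c f. cycle_of_list c \<circ> f) cs id a = cycle_of_list c a"
  using assms
proof (induction cs)
  case (Cons d ds)
  show ?case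
  proof (cases "a \<in> set d")
    case True
    then have "a \<notin> set (concat ds)"
      using Cons.prems(1) by auto
    moreover from this have "c = d"
      using Cons.prems by auto
    ultimately show ?thesis
      using foldr_cycles_outside[of a ds] by (metis comp_apply foldr.simps(2))
  next
    case False
    then have "c \<in> set ds"
      using Cons.prems by auto
    moreover from this have "cycle_of_list c a \<notin> set d"
      using cycle_of_list_in[OF Cons.prems(3)] Cons.prems(1) by auto
    ultimately show ?thesis
      using Cons by (auto simp: id_outside_supp)
  qed
qed simp

text \<open>The induction follows the recursion of \<open>cycle_of_list\<close>: prepending
  \<open>i\<close> to a cycle opened by \<open>j\<close> composes it with
  \<open>transpose i j\<close>. So \<open>i\<close> is sent to \<open>j\<close>, the letter formerly
  sent to \<open>j\<close> now closes the cycle at \<open>i\<close>, and all other images are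
  unchanged.\<close>

lemma cycle_of_list_cases:
  assumes "distinct c" "a \<in> set c" "cycle_of_list c a \<noteq> a"
  shows "(\<exists>u v. c = u @ a # cycle_of_list c a # v) \<or> (\<exists>v. c = cycle_of_list c a # v @ [a])"
  using assms
proof (induction c rule: cycle_of_list.induct)
  case (1 i j cs)
  show ?case
  proof (cases "a = i")
    case True
    then have "cycle_of_list (i # j # cs) a = j"
      using 1 by (simp add: id_outside_supp)
    then show ?thesis
      using True by (metis append_Nil)
  next
    case False
    define b where "b = cycle_of_list (j # cs) a"
    have eq: "cycle_of_list (i # j # cs) a = transpose i j b"
      by (simp add: b_def)
    have a: "a \<in> set (j # cs)"
      using 1 False by auto
    have b: "b \<in> set (j # cs)" "b \<noteq> i"
      using cycle_of_list_in[OF a] 1 by (auto simp: b_def)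
    show ?thesis
    proof (cases "b = j")
      case True
      have "\<exists>v. i # j # cs = i # v @ [a]"
      proof (cases "a = j")
        case True
        \<comment> \<open>Here \<open>a\<close> is fixed by the shorter cycle, so the induction
          hypothesis does not apply; a fixed head forces a cycle of length one.\<close>
        have "cs = []"
        proof (rule ccontr)
          assume "cs \<noteq> []"
          then obtain l ls where "cs = l # ls"
            by (cases cs) auto
          then have "cycle_of_list (j # cs) j = l"
            using 1 by (simp add: id_outside_supp)
          then show False
            using \<open>b = j\<close> \<open>a = j\<close> \<open>cs = l # ls\<close> "1.prems"(1) by (simp add: b_def)
        qed
        then show ?thesis
          using True by simp
      next
        case False
        then have "(\<exists>u v. j # cs = u @ a # j # v) \<or> (\<exists>v. j # cs = j # v @ [a])"
          using "1.IH" 1 a \<open>b = j\<close> by (auto simp: b_def)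
        then show ?thesis
        proof
          assume "\<exists>u v. j # cs = u @ a # j # v"
          then show ?thesis
            \<comment> \<open>As \<open>a \<noteq> j\<close>, this alternative would make
              \<open>j\<close> occur twice in \<open>j # cs\<close>.\<close>
            using "1.prems"(1) False by (auto simp: Cons_eq_append_conv)
        next
          assume "\<exists>v. j # cs = j # v @ [a]"
          then show ?thesis
            by (metis append_Cons)
        qed
      qed
      then show ?thesis
        using eq True by simp
    next
      case False
      then have b': "cycle_of_list (i # j # cs) a = b"
        using eq b by simp
      then have "(\<exists>u v. j # cs = u @ a # b # v) \<or> (\<exists>v. j # cs = b # v @ [a])"
        using "1.IH" 1 a by (auto simp: b_def)
      then show ?thesis
        using False b' by (metis append_Cons list.inject)
    qed
  qed
qed auto

text \<open>An entry that is not a left-to-right maximum is bounded by an earlier entry. Inside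
  \<open>t\<close> this descends, by strong induction on the position, to \<open>b\<close> or to an
  entry of \<open>u\<close>.\<close>

lemma less_of_not_Lmax:
  assumes w: "w = u @ b # t @ v" and "distinct w"
    and "u = [] \<or> b \<in> Lmax w" "set t \<inter> Lmax w = {}"
    and "y \<in> set (u @ t)"
  shows "y < b"
proof -
  have nth_b: "w ! length u = b"
    using w by simp
  have u_less: "w ! m < b" if "m < length u" for m
  proof -
    have "b \<in> Lmax w"
      using assms(3) that by auto
    then obtain q where q: "q < length w" "w ! q = b" "\<forall>j<q. w ! j < w ! q"
      by (auto simp: Lmax_def)
    then have "q = length u"
      using nth_b nth_eq_iff_index_eq[OF \<open>distinct w\<close> q(1), of "length u"] q(2) w by simp
    then show ?thesis
      using q that by auto
  qed
  \<comment> \<open>The bound is weak because the range includes the position of \<open>b\<close>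
    itself; distinctness makes it strict at the end.\<close>
  have le: "w ! m \<le> b" if "m \<le> length u + length t" for m
    using that
  proof (induction m rule: less_induct)
    case (less m)
    consider "m < length u" | "m = length u" | "m > length u"
      by linarith
    then show ?case
    proof cases
      case 3
      then have "w ! m = t ! (m - Suc (length u))" "m - Suc (length u) < length t"
        using less.prems w by (auto simp: nth_append nth_Cons')
      then have "w ! m \<notin> Lmax w"
        using assms(4) by (metis disjoint_iff nth_mem)
      moreover have "m < length w"
        using less.prems w by simp
      ultimately have "\<not> (\<forall>j<m. w ! j < w ! m)"
        unfolding Lmax_def by blast
      then obtain j where "j < m" "w ! m \<le> w ! j"
        by (meson not_less)
      then show ?thesis
        using less.IH[of j] less.prems by simp
    qed (use u_less nth_b in \<open>auto intro: less_imp_le\<close>)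
  qed
  have "y \<in> set (take (length u + Suc (length t)) w)"
    using assms(5) w by auto
  then obtain m where "m < length u + Suc (length t)" "y = w ! m"
    by (auto simp: in_set_conv_nth)
  then have "y \<le> b"
    using le[of m] by simp
  moreover have "y \<noteq> b"
    using assms(5) w \<open>distinct w\<close> by auto
  ultimately show ?thesis
    by simp
qed

lemma hat_cases:
  assumes "distinct w" "hat w a = b" "a \<noteq> b"
  obtains (adjacent) u v where "w = u @ a # b # v"
  | (closing) u t v where "w = u @ b # t @ a # v" "\<forall>y\<in>set (a # u @ t). y < b"
proof -
  let ?cs = "cut_before (Lmax w) w"
  \<comment> \<open>A letter outside every block would be fixed by \<open>hat w\<close>.\<close>
  have "a \<in> set (concat ?cs)"
    using foldr_cycles_outside[of a ?cs] assms(2,3) by (auto simp: hat_def)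
  then obtain c where c: "c \<in> set ?cs" "a \<in> set c"
    by auto
  then have b: "cycle_of_list c a = b"
    using foldr_cycles_inside[of ?cs c a] assms by (simp add: hat_def concat_cut_before)
  obtain u v where uv: "w = u @ c @ v" "set (tl c) \<inter> Lmax w = {}" "u = [] \<or> hd c \<in> Lmax w"
    using cut_before_block[OF c(1)] by blast
  have "distinct c"
    using uv assms(1) by simp
  then consider u' v' where "c = u' @ a # b # v'" | t where "c = b # t @ [a]"
    using cycle_of_list_cases[of c a] c b assms(3) by auto
  then show thesis
  proof cases
    case 1
    then show thesis
      using uv(1) adjacent[of "u @ u'" "v' @ v"] by simp
  next
    case (2 t)
    then have "y < b" if "y \<in> set (u @ t @ [a])" for y
      using less_of_not_Lmax[of w u b "t @ [a]" v y] uv assms(1) that by simp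
    then show thesis
      using uv(1) 2 closing[of u t v] by simp
  qed
qed

section \<open>Occurrences as subsequences\<close>

text \<open>This trades the position function \<open>t\<close> for the library's
  \<open>subseq\<close>, so that inserting a letter into an occurrence becomes an argument about
  concatenations.\<close>

lemma subseq_iff_nth:
  "subseq v w \<longleftrightarrow> (\<exists>t. strict_mono_on {..<length v} t \<and> t ` {..<length v} \<subseteq> {..<length w} \<and>
     (\<forall>j<length v. w ! t j = v ! j))"
  (is "_ \<longleftrightarrow> (\<exists>t. ?P v w t)")
proof
  assume "subseq v w"
  then show "\<exists>t. ?P v w t"
  proof induction
    case (list_emb_Nil ys)
    then show ?case
      by (auto simp: strict_mono_on_def)
  next
    case (list_emb_Cons xs ys y)
    then obtain t where "?P xs ys t"
      by blast
    then have "?P xs (y # ys) (Suc \<circ> t)"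
      by (auto simp: strict_mono_on_def)
    then show ?case
      by blast
  next
    case (list_emb_Cons2 x y xs ys)
    then obtain t where "?P xs ys t"
      by blast
    \<comment> \<open>The new head is matched at position 0 and all old positions shift by
      one.\<close>
    then have "?P (x # xs) (y # ys) (case_nat 0 (Suc \<circ> t))"
      using list_emb_Cons2(1)
      by (auto simp: strict_mono_on_def image_subset_iff split: nat.splits)
    then show ?case
      by blast
  qed
next
  assume "\<exists>t. ?P v w t"
  then show "subseq v w"
  proof (induction v arbitrary: w rule: rev_induct)
    case (snoc y v)
    then obtain t where t: "?P (v @ [y]) w t"
      by blast
    \<comment> \<open>The word is split at the position matching the last letter \<open>y\<close>;
      monotonicity of \<open>t\<close> puts all of \<open>v\<close> strictly before it.\<close>
    let ?m = "t (length v)"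
    have m: "?m < length w" "w ! ?m = y"
      using t by (auto simp: image_subset_iff)
    have less: "t j < ?m" if "j < length v" for j
      using t that by (auto simp: strict_mono_on_def)
    have "?P v (take ?m w) t"
      using t less m(1) by (auto simp: strict_mono_on_def nth_append split: if_splits)
    then have "subseq v (take ?m w)"
      using snoc.IH by blast
    moreover have "subseq [y] (drop ?m w)"
      using m by (metis Cons_nth_drop_Suc list_emb_Nil subseq_Cons2)
    ultimately have "subseq (v @ [y]) (take ?m w @ drop ?m w)"
      by (rule list_emb_append_mono)
    then show ?case
      by simp
  qed simp
qed

lemma contains_pattern_iff_subseq:
  "contains_pattern w (\<nu>, {(b, c)}) \<longleftrightarrow> (\<exists>x. strict_mono_on {1..pattern_size (\<nu>, {(b, c)})} x \<and>
     x ` {1..pattern_size (\<nu>, {(b, c)})} \<subseteq> {1..length w} \<and> subseq (map x \<nu>) w \<and> hat w (x b) = x c)"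
  unfolding contains_pattern_def subseq_iff_nth length_map case_prod_conv
  by (intro arg_cong[where f = Ex] ext) (simp, blast)

lemma subseq_imp_set_subset: "subseq v w \<Longrightarrow> set v \<subseteq> set w"
  by (induction rule: list_emb.induct) auto

text \<open>By distinctness, \<open>z\<close> can only be matched with its unique occurrence, so the
  embedding splits there.\<close>

lemma subseq_around:
  assumes "subseq (A @ z # C) (u @ z # v)" "distinct (u @ z # v)"
  shows "subseq A u" "subseq C v"
proof -
  obtain w1 w2 where w: "u @ z # v = w1 @ w2" "subseq A w1" "subseq (z # C) w2"
    using list_emb_appendD[OF assms(1)] by blast
  obtain u' v' where w2: "w2 = u' @ z # v'" "subseq C v'"
    using list_emb_ConsD[OF w(3)] by blast
  have "z \<notin> set u" "z \<notin> set v"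
    using assms(2) by auto
  moreover have "u @ z # v = (w1 @ u') @ z # v'"
    using w w2 by simp
  ultimately have "u = w1 @ u' \<and> v = v'"
    using append_Cons_eq_iff[of z u v "w1 @ u'" v'] by simp
  then show "subseq A u" "subseq C v"
    using w(2) w2(2) by auto
qed

lemma subseq_snocD:
  assumes "subseq A (u @ [a])" "a \<notin> set A"
  shows "subseq A u"
proof -
  obtain A1 A2 where A: "A = A1 @ A2" "subseq A1 u" "subseq A2 [a]"
    using assms(1) by (auto simp: subseq_append_iff)
  moreover from this have "A2 = []"
    using assms(2) by (cases A2) (auto split: if_splits)
  ultimately show ?thesis
    by simp
qed

lemma subseq_insert_before:
  assumes "subseq (A @ b # C) (u @ a # b # v)" "distinct (u @ a # b # v)" "a \<notin> set A"
  shows "subseq (A @ a # b # C) (u @ a # b # v)"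
proof -
  have "subseq A (u @ [a])" "subseq C v"
    using subseq_around[of A b C "u @ [a]" v] assms by auto
  then show ?thesis
    using subseq_snocD[OF _ assms(3)] by (simp add: list_emb_append_mono)
qed

lemma subseq_insert_after:
  assumes "subseq (A @ a # C) (u @ a # b # v)" "distinct (u @ a # b # v)" "b \<notin> set C"
  shows "subseq (A @ a # b # C) (u @ a # b # v)"
proof -
  have "subseq A u" "subseq C (b # v)"
    using subseq_around[of A a C u "b # v"] assms by auto
  moreover from this have "subseq C v"
    using assms(3) by (cases C) auto
  ultimately show ?thesis
    by (simp add: list_emb_append_mono)
qed

section \<open>The three patterns\<close>

text \<open>Here \<open>a\<close> and \<open>b\<close> are the actual values at the source and
  target of the arrow. The case \<open>closing\<close> contradicts the sixth assumption, since there
  \<open>b\<close> exceeds \<open>a\<close> and every letter that \<open>A\<close> can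
  contain.\<close>

lemma insert_arrow_letter:
  assumes "distinct w" "hat w a = b" "a \<noteq> b" "a \<notin> set (A @ C)" "b \<notin> set (A @ C)"
    and "b < a \<or> (\<exists>y\<in>set A. b < y)"
    and "subseq (A @ b # C) w \<or> subseq (A @ a # C) w"
  shows "subseq (A @ a # b # C) w"
  using assms(1-3)
proof (cases rule: hat_cases)
  case (adjacent u v)
  then show ?thesis
    using assms(1,4,5,7) subseq_insert_before[of A b C u a v] subseq_insert_after[of A a C u b v]
    by auto
next
  case (closing u t v)
  \<comment> \<open>Whichever of \<open>a\<close> and \<open>b\<close> is present, the letters of
    \<open>A\<close> precede it in \<open>w\<close>, hence precede \<open>a\<close>.\<close>
  have "set A \<subseteq> set (u @ b # t)"
    using assms(7)
  proof
    assume "subseq (A @ b # C) w"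
    then have "subseq A u"
      using subseq_around[of A b C u "t @ a # v"] closing(1) assms(1) by simp
    then show ?thesis
      using subseq_imp_set_subset by fastforce
  next
    assume "subseq (A @ a # C) w"
    then have "subseq A (u @ b # t)"
      using subseq_around[of A a C "u @ b # t" v] closing(1) assms(1) by simp
    then show ?thesis
      using subseq_imp_set_subset by fastforce
  qed
  then have "y < b" if "y \<in> set A" for y
    using that closing(2) assms(5) by auto
  moreover have "a < b"
    using closing(2) by simp
  ultimately show ?thesis
    using assms(6) by (meson less_asym)
qed

lemma contains_pattern_insert_letter:
  assumes "distinct w" "c \<noteq> r" "r \<notin> set (A @ C)" "c \<notin> set (A @ C)"
    and letters: "insert r (insert c (set (A @ C))) = {1..k}"
    and "c < r \<or> (\<exists>y\<in>set A. c < y)"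
    and \<nu>: "\<nu> = A @ c # C \<or> \<nu> = A @ r # C"
  shows "contains_pattern w (\<nu>, {(r, c)}) \<longleftrightarrow> contains_pattern w (A @ r # c # C, {(r, c)})"
proof -
  have "letters (\<nu>, {(r, c)}) = insert r (insert c (set (A @ C)))"
    "letters (A @ r # c # C, {(r, c)}) = insert r (insert c (set (A @ C)))"
    using \<nu> by (auto simp: letters_def Field_def)
  then have size: "pattern_size (\<nu>, {(r, c)}) = k" "pattern_size (A @ r # c # C, {(r, c)}) = k"
    by (simp_all only: pattern_size_def letters card_atLeastAtMost)
  \<comment> \<open>The two patterns have the same letters and the same arrow, so one and the same
    enumeration \<open>x\<close> serves both.\<close>
  have "subseq (map x \<nu>) w \<longleftrightarrow> subseq (map x (A @ r # c # C)) w"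
    if x: "strict_mono_on {1..k} x" "hat w (x r) = x c" for x
  proof
    have inj: "inj_on x {1..k}"
      using x(1) by (rule strict_mono_on_imp_inj_on)
    have in_k: "r \<in> {1..k}" "c \<in> {1..k}" "set (A @ C) \<subseteq> {1..k}"
      unfolding letters[symmetric] by auto
    assume "subseq (map x \<nu>) w"
    then have "subseq (map x A @ x c # map x C) w \<or> subseq (map x A @ x r # map x C) w"
      using \<nu> by auto
    moreover have "x r \<noteq> x c"
      using inj in_k assms(2) by (auto dest: inj_onD)
    moreover have "x r \<notin> set (map x A @ map x C)" "x c \<notin> set (map x A @ map x C)"
      using inj_on_image_mem_iff[OF inj _ in_k(3)] in_k(1,2) assms(3,4)
      by (simp_all flip: map_append)
    moreover have "x c < x r \<or> (\<exists>y\<in>set (map x A). x c < y)"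
      using assms(6) in_k strict_mono_onD[OF x(1)] by fastforce
    ultimately show "subseq (map x (A @ r # c # C)) w"
      using insert_arrow_letter[OF assms(1) x(2)] by simp
  next
    have "subseq \<nu> (A @ r # c # C)"
      using \<nu> by (auto intro!: list_emb_append_mono)
    then have "subseq (map x \<nu>) (map x (A @ r # c # C))"
      by (rule subseq_map)
    moreover assume "subseq (map x (A @ r # c # C)) w"
    ultimately show "subseq (map x \<nu>) w"
      by (rule subseq_order.trans)
  qed
  then show ?thesis
    unfolding contains_pattern_iff_subseq size by blast
qed

theorem proposition2p3:
  fixes \<nu> :: "nat list" and k r i :: nat
  assumes "distinct \<nu>" and "set \<nu> \<subseteq> {1..k}" and "length \<nu> = k - 1"
    and "{1..k} - set \<nu> = {r}"
    and "i \<in> {1..k - 1}"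
    and "r > \<nu> ! (i - 1) \<or> \<nu> ! (i - 1) \<notin> Lmax \<nu>"
  shows "(\<nu>, {(r, \<nu> ! (i - 1))}) \<sim> (\<nu>[i - 1 := r], {(r, \<nu> ! (i - 1))}) \<and>
         (\<nu>[i - 1 := r], {(r, \<nu> ! (i - 1))}) \<sim>
           (take (i - 1) \<nu> @ r # drop (i - 1) \<nu>, {(r, \<nu> ! (i - 1))})"
proof -
  define m where "m = i - 1"
  define A where "A = take m \<nu>"
  define C where "C = drop (Suc m) \<nu>"
  define c where "c = \<nu> ! m"
  have m: "m < length \<nu>"
    using assms(3,5) by (auto simp: m_def)
  have drop: "drop m \<nu> = c # C"
    using m by (simp add: C_def c_def Cons_nth_drop_Suc)
  have \<nu>: "\<nu> = A @ c # C"
    using append_take_drop_id[of m \<nu>] by (simp add: A_def drop)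
  have upd: "\<nu>[m := r] = A @ r # C"
    using m by (simp add: upd_conv_take_nth_drop A_def C_def)
  have r: "r \<notin> set \<nu>"
    using assms(4) by blast
  have letters: "insert r (insert c (set (A @ C))) = {1..k}"
    using assms(2,4) \<nu> by auto
  have fresh: "c \<noteq> r" "r \<notin> set (A @ C)" "c \<notin> set (A @ C)" "distinct (A @ C)"
    using r assms(1) \<nu> by auto
  \<comment> \<open>If \<open>c < r\<close> fails, \<open>c\<close> is not a left-to-right maximum
    of \<open>\<nu>\<close>, and distinctness yields a strictly larger letter before it, that is, in
    \<open>A\<close>.\<close>
  have greater: "c < r \<or> (\<exists>y\<in>set A. c < y)"
  proof (cases "c < r")
    case False
    then have "\<nu> ! m \<notin> Lmax \<nu>"
      using assms(6) by (simp add: c_def m_def)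
    then obtain j where j: "j < m" "\<nu> ! m \<le> \<nu> ! j"
      using m by (auto simp: Lmax_def not_less)
    then have "\<nu> ! m < \<nu> ! j"
      using m assms(1) by (simp add: nth_eq_iff_index_eq order_less_le)
    moreover have "\<nu> ! j \<in> set A"
      using j m by (auto simp: A_def in_set_conv_nth intro!: exI[of _ j])
    ultimately show ?thesis
      by (auto simp: c_def)
  qed simp
  have contains: "contains_pattern w (\<mu>, {(r, c)}) \<longleftrightarrow> contains_pattern w (A @ r # c # C, {(r, c)})"
    if "distinct w" "\<mu> = A @ c # C \<or> \<mu> = A @ r # C" for w \<mu>
    using contains_pattern_insert_letter that fresh letters greater by blast
  have "avoiders n (\<mu>, {(r, c)}) = avoiders n (A @ r # c # C, {(r, c)})"
    if "\<mu> = A @ c # C \<or> \<mu> = A @ r # C" for n \<mu>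
    using contains[OF _ that] by (auto simp: avoiders_def dest: permutations_of_setD)
  moreover have "arrow_pattern (\<mu>, {(r, c)})"
    if "\<mu> = A @ c # C \<or> \<mu> = A @ r # C \<or> \<mu> = A @ r # c # C" for \<mu>
  proof -
    have "letters (\<mu>, {(r, c)}) = insert r (insert c (set (A @ C)))"
      using that by (auto simp: letters_def Field_def)
    then have "letters (\<mu>, {(r, c)}) = {1..k}"
      using letters by (rule trans)
    moreover have "distinct \<mu>"
      using that fresh by auto
    ultimately show ?thesis
      by (simp only: arrow_pattern_def pattern_size_def) simp
  qed
  ultimately have "(A @ c # C, {(r, c)}) \<sim> (A @ r # C, {(r, c)}) \<and>
      (A @ r # C, {(r, c)}) \<sim> (A @ r # c # C, {(r, c)})"
    by (simp add: arrow_Wilf_equiv_def)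
  moreover have "take m \<nu> @ r # drop m \<nu> = A @ r # c # C"
    by (simp add: A_def drop)
  ultimately show ?thesis
    unfolding m_def[symmetric] c_def[symmetric] upd using \<nu> by simp
qed

end
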